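(* Let $\mu$ be a countably atomic (potentially signed) measure with support in $[0,\infty)$, with moments $\gamma_n = \int t^n\,d\mu(t)$, and let $W_\alpha$ be the weighted shift with weights $\alpha_n = \sqrt{\gamma_{n+1}/\gamma_n}$. (1) If $\mu$ has all negative or all positive densities, then $W_\alpha$ is subnormal and hence conditionally positive definite in the sense of CPD-weights. (2) If $\mu$ has two atoms with one density of each sign, then there are exactly two (non-zero) constants which, multiplying the weights of $W_\alpha$, make it CPD-weights. (3) If $\mu$ has more than two atoms, with either all positive densities but one or all negative densities but one, then there exists exactly one (non-zero) multiplier of the weights of $W_\alpha$ producing a CPD-weights shift. (4) If $\mu$ has at least two atoms with positive densities and at least two with negative densities, then no non-zero multiple of $W_\alpha$ is CPD-weights.
   Context: A countably atomic measure is $\mu = \sum_i a_i\delta_{r_i}$, a finite or countably infinite sum with distinct atoms $r_i$ and real non-zero densities $a_i$; as elsewhere in the paper it is a finite signed measure with compact support, and it is assumed that the ratios $\gamma_{n+1}/\gamma_n$ are well defined and positive, so that $W_\alpha$ makes sense. The weighted shift $W_\alpha$ acts on $\ell^2$ with standard basis $\{e_j\}_{j\ge0}$ by $W_\alpha e_j = \alpha_j e_{j+1}$; it is subnormal iff its moments $1,\ \alpha_0^2,\ \alpha_0^2\alpha_1^2,\ldots$ are the power moments of a probability measure compactly supported in $[0,\infty)$. Multipliers of the weights are positive constants $\sqrt{k}$, $k>0$; multiplying the weights by $\sqrt{k}$ replaces $\gamma_n$ by $k^n\gamma_n$. For a sequence $c$, $(\Delta c)_n = c_{n+1}-c_n$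 and $\Delta^2 c = \Delta(\Delta c)$. A shift with moment sequence $\gamma$ is called "CPD-weights" if $\Delta^2\gamma$ yields the moment sequence of a subnormal shift, where only the weights (ratios of successive moments) matter, so that an overall non-zero scalar factor, including a negative one, is allowed; i.e. there is a finite positive Borel measure $\rho$ compactly supported in $[0,\infty)$ such that either $(\Delta^2\gamma)_n = \int t^n\,d\rho(t)$ for all $n\ge0$, or $(\Delta^2\gamma)_n = -\int t^n\,d\rho(t)$ for all $n\ge0$. Convention: $0^0=1$.
   Formalization: In (2) both atoms are assumed nonzero, and in (3) the single atom of odd sign is assumed nonzero; otherwise the claims fail: 2δ_1 − δ_0 has only one multiplier, and 2δ_1 + 2δ_2 − δ_0 has none. *)

theory Defs
  imports "HOL-Analysis.Analysis"
begin

section \<open>Operators on the complex sequence space and subnormality\<close>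

definition l2 :: "('i \<Rightarrow> complex) set" where
  "l2 = {x. (\<lambda>i. (cmod (x i))\<^sup>2) summable_on UNIV}"

definition l2_inner :: "('i \<Rightarrow> complex) \<Rightarrow> ('i \<Rightarrow> complex) \<Rightarrow> complex" where
  "l2_inner x y = (\<Sum>\<^sub>\<infinity>i. x i * cnj (y i))"

definition l2_norm :: "('i \<Rightarrow> complex) \<Rightarrow> real" where
  "l2_norm x = sqrt (\<Sum>\<^sub>\<infinity>i. (cmod (x i))\<^sup>2)"

definition bounded_operator :: "(('i \<Rightarrow> complex) \<Rightarrow> ('j \<Rightarrow> complex)) \<Rightarrow> bool" where
  "bounded_operator T \<longleftrightarrow>
     (\<forall>x\<in>l2. T x \<in> l2) \<and>
     (\<forall>x\<in>l2. \<forall>y\<in>l2. T (\<lambda>i. x i + y i) = (\<lambda>j. T x j + T y j)) \<and>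
     (\<forall>c. \<forall>x\<in>l2. T (\<lambda>i. c * x i) = (\<lambda>j. c * T x j)) \<and>
     (\<exists>B. \<forall>x\<in>l2. l2_norm (T x) \<le> B * l2_norm x)"

definition adjoint_pair ::
  "(('i \<Rightarrow> complex) \<Rightarrow> ('i \<Rightarrow> complex)) \<Rightarrow> (('i \<Rightarrow> complex) \<Rightarrow> ('i \<Rightarrow> complex)) \<Rightarrow> bool" where
  "adjoint_pair T S \<longleftrightarrow> (\<forall>x\<in>l2. \<forall>y\<in>l2. l2_inner (T x) y = l2_inner x (S y))"

definition normal_operator :: "(('i \<Rightarrow> complex) \<Rightarrow> ('i \<Rightarrow> complex)) \<Rightarrow> bool" where
  "normal_operator N \<longleftrightarrow> bounded_operator N \<and>
     (\<exists>S. bounded_operator S \<and> adjoint_pair N S \<and> (\<forall>x\<in>l2. N (S x) = S (N x)))"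

text \<open>
  An operator is subnormal if it is the restriction of a normal operator on some larger Hilbert
  space to an invariant subspace. HOL cannot quantify over the larger space as a type, so the
  inclusion is an isometry \<open>V\<close> into a second copy of the sequence space. This loses nothing: the
  minimal normal extension of an operator on a separable infinite-dimensional Hilbert space is
  again separable and infinite-dimensional.
\<close>

definition subnormal :: "((nat \<Rightarrow> complex) \<Rightarrow> (nat \<Rightarrow> complex)) \<Rightarrow> bool" where
  "subnormal T \<longleftrightarrow> bounded_operator T \<and>
     (\<exists>(N :: (nat \<Rightarrow> complex) \<Rightarrow> (nat \<Rightarrow> complex)) (V :: (nat \<Rightarrow> complex) \<Rightarrow> (nat \<Rightarrow> complex)).
        normal_operator N \<and> bounded_operator V \<and>
        (\<forall>x\<in>l2. l2_norm (V x) = l2_norm x) \<and>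
        (\<forall>x\<in>l2. N (V x) = V (T x)))"

definition weighted_shift :: "(nat \<Rightarrow> real) \<Rightarrow> (nat \<Rightarrow> complex) \<Rightarrow> (nat \<Rightarrow> complex)" where
  "weighted_shift \<alpha> x = (\<lambda>n. case n of 0 \<Rightarrow> 0 | Suc j \<Rightarrow> complex_of_real (\<alpha> j) * x j)"


section \<open>Moments and CPD-weights\<close>

definition shift_moment :: "(nat \<Rightarrow> real) \<Rightarrow> nat \<Rightarrow> real" where
  "shift_moment \<alpha> n = (\<Prod>j<n. (\<alpha> j)\<^sup>2)"

definition fdiff :: "(nat \<Rightarrow> real) \<Rightarrow> nat \<Rightarrow> real" where
  "fdiff c n = c (Suc n) - c n"

definition compactly_supported_nonneg :: "real measure \<Rightarrow> bool" where
  "compactly_supported_nonneg \<rho> \<longleftrightarrow> (\<exists>R. emeasure \<rho> (- {0..R}) = 0)"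

text \<open>
  The moments of a shift are normalised to start with 1. Passing from any other sequence
  \<open>\<gamma>\<close> with the same ratios to these only divides by \<open>\<gamma> 0\<close>, which the choice of sign absorbs.
\<close>

definition CPD_weights :: "(nat \<Rightarrow> real) \<Rightarrow> bool" where
  "CPD_weights \<alpha> \<longleftrightarrow>
     (\<exists>\<rho> :: real measure. sets \<rho> = sets borel \<and> finite_measure \<rho> \<and> compactly_supported_nonneg \<rho> \<and>
        ((\<forall>n. fdiff (fdiff (shift_moment \<alpha>)) n = (\<integral>t. t ^ n \<partial>\<rho>)) \<or>
         (\<forall>n. fdiff (fdiff (shift_moment \<alpha>)) n = - (\<integral>t. t ^ n \<partial>\<rho>))))"


section \<open>Countably atomic signed measures\<close>

text \<open>
  The triple \<open>(I, a, r)\<close> stands for the signed measure \<open>\<Sum>i\<in>I. a i * \<delta>(r i)\<close>;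
  summability of the densities is finiteness of its total variation.

  Multiplying the weights by \<open>c\<close> moves the atom \<open>r i\<close> to \<open>c\<^sup>2 * r i\<close>, and the second difference
  then multiplies its density by \<open>(c\<^sup>2 * r i - 1)\<^sup>2\<close>. An atom at 0 therefore survives for every
  multiplier, so existence claims for multipliers must exclude that the atoms to be cancelled are
  at 0: for \<open>2 * \<delta>(1) - \<delta>(0)\<close> only \<open>c = 1\<close> gives CPD-weights.
\<close>

definition countably_atomic :: "'i set \<Rightarrow> ('i \<Rightarrow> real) \<Rightarrow> ('i \<Rightarrow> real) \<Rightarrow> bool" where
  "countably_atomic I a r \<longleftrightarrow> countable I \<and> inj_on r I \<and> (\<forall>i\<in>I. a i \<noteq> 0) \<and>
     (\<lambda>i. \<bar>a i\<bar>) summable_on I \<and> bounded (r ` I)"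

definition atomic_moment :: "'i set \<Rightarrow> ('i \<Rightarrow> real) \<Rightarrow> ('i \<Rightarrow> real) \<Rightarrow> nat \<Rightarrow> real" where
  "atomic_moment I a r n = (\<Sum>\<^sub>\<infinity>i\<in>I. a i * r i ^ n)"

end

theory Submission
  imports Defs
begin

text \<open>
  Multiplying the weights by \<open>c\<close> and taking second differences turns \<open>\<Sum>i. a i * \<delta>(r i)\<close> into
  \<open>\<Sum>i. a i * (c\<^sup>2 * r i - 1)\<^sup>2 * \<delta>(c\<^sup>2 * r i)\<close>, up to a constant factor. Since a compactly
  supported measure is determined by its moments, the shift has CPD-weights iff these new densities
  all have the same weak sign. The multiplier can cancel only an atom with \<open>c\<^sup>2 * r i = 1\<close>, hence at
  most one; counting the atoms of each sign gives the four cases. Subnormality for densities of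
  one sign comes from an explicit normal extension.
\<close>

section \<open>Subnormality\<close>

text \<open>Partition the target index set into the fibres of \<open>f\<close>. On the fibre over
  \<open>i\<close> the factor \<open>x i\<close> is constant, so its contribution is the total
  squared weight \<open>u i\<close> of that fibre times the squared modulus of \<open>x i\<close>.
  Permutations, shifts and the isometric embedding all have this form.\<close>

lemma has_sum_weighted_composition:
  fixes w :: "'j \<Rightarrow> real" and f :: "'j \<Rightarrow> 'i"
  assumes fib: "\<And>i. ((\<lambda>j. (w j)\<^sup>2) has_sum u i) {j. f j = i}" and B: "\<And>i. u i \<le> B"
    and x: "x \<in> l2"
  shows "((\<lambda>j. (cmod (complex_of_real (w j) * x (f j)))\<^sup>2) has_sum
           (\<Sum>\<^sub>\<infinity>i. u i * (cmod (x i))\<^sup>2)) UNIV"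
    and "(\<lambda>i. u i * (cmod (x i))\<^sup>2) summable_on UNIV"
proof -
  have xs: "(\<lambda>i. (cmod (x i))\<^sup>2) summable_on UNIV"
    using x by (simp add: l2_def)
  have u0: "0 \<le> u i" for i
    using fib[of i] by (rule has_sum_nonneg) auto
  show us: "(\<lambda>i. u i * (cmod (x i))\<^sup>2) summable_on UNIV"
    by (rule summable_on_comparison_test[OF summable_on_cmult_right[OF xs, of B]])
       (auto intro!: mult_right_mono B simp: u0)
  let ?g = "\<lambda>p. (cmod (complex_of_real (w (snd p)) * x (f (snd p))))\<^sup>2"
  have *: "((\<lambda>j. ?g (i, j)) has_sum u i * (cmod (x i))\<^sup>2) {j. f j = i}" for i
    using has_sum_cmult_left[OF fib[of i], of "(cmod (x i))\<^sup>2"]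
    by (subst has_sum_cong[where g = "\<lambda>j. (w j)\<^sup>2 * (cmod (x i))\<^sup>2"])
       (auto simp: norm_mult power_mult_distrib)
  have "(?g has_sum (\<Sum>\<^sub>\<infinity>i. u i * (cmod (x i))\<^sup>2)) (SIGMA i:UNIV. {j. f j = i})"
    by (rule has_sum_SigmaI[OF *], use us in simp, rule summable_on_SigmaI[OF * us]) auto
  moreover have "bij_betw (\<lambda>j. (f j, j)) UNIV (SIGMA i:UNIV. {j. f j = i})"
    by (rule bij_betwI[where g = snd]) auto
  ultimately show "((\<lambda>j. (cmod (complex_of_real (w j) * x (f j)))\<^sup>2) has_sum
           (\<Sum>\<^sub>\<infinity>i. u i * (cmod (x i))\<^sup>2)) UNIV"
    by (subst (asm) has_sum_reindex_bij_betw[symmetric]) auto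
qed

lemma bounded_weighted_composition:
  fixes w :: "'j \<Rightarrow> real" and f :: "'j \<Rightarrow> 'i"
  assumes fib: "\<And>i. ((\<lambda>j. (w j)\<^sup>2) has_sum u i) {j. f j = i}" and B: "\<And>i. u i \<le> B"
  shows "bounded_operator (\<lambda>x j. complex_of_real (w j) * x (f j))"
proof -
  have "l2_norm (\<lambda>j. complex_of_real (w j) * x (f j)) \<le> sqrt B * l2_norm x" if x: "x \<in> l2" for x
  proof -
    note h = has_sum_weighted_composition[OF fib B x]
    have xs: "(\<lambda>i. (cmod (x i))\<^sup>2) summable_on UNIV"
      using x by (simp add: l2_def)
    have "l2_norm (\<lambda>j. complex_of_real (w j) * x (f j)) = sqrt (\<Sum>\<^sub>\<infinity>i. u i * (cmod (x i))\<^sup>2)"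
      unfolding l2_norm_def using infsumI[OF h(1)] by simp
    also have "\<dots> \<le> sqrt (\<Sum>\<^sub>\<infinity>i. B * (cmod (x i))\<^sup>2)"
      by (intro real_sqrt_le_mono infsum_mono h summable_on_cmult_right xs mult_right_mono B) auto
    also have "\<dots> = sqrt B * l2_norm x"
      unfolding l2_norm_def by (simp add: infsum_cmult_right[OF xs] real_sqrt_mult)
    finally show ?thesis .
  qed
  moreover have "(\<lambda>j. complex_of_real (w j) * x (f j)) \<in> l2" if "x \<in> l2" for x
    using has_sum_weighted_composition(1)[OF fib B that] unfolding l2_def
    by (auto simp: summable_on_def)
  ultimately show ?thesis
    unfolding bounded_operator_def by (intro conjI exI[of _ "sqrt B"]) (auto simp: algebra_simps)
qed

lemma isometric_weighted_composition:
  fixes w :: "'j \<Rightarrow> real" and f :: "'j \<Rightarrow> 'i"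
  assumes "\<And>i. ((\<lambda>j. (w j)\<^sup>2) has_sum 1) {j. f j = i}" and "x \<in> l2"
  shows "l2_norm (\<lambda>j. complex_of_real (w j) * x (f j)) = l2_norm x"
  using infsumI[OF has_sum_weighted_composition(1)[OF assms(1) order.refl assms(2)]]
  unfolding l2_norm_def by simp

lemma bounded_weighted_permutation:
  fixes \<sigma> :: "'i \<Rightarrow> 'i" and s :: "'i \<Rightarrow> real"
  assumes "bij \<sigma>" and "\<And>n. (s n)\<^sup>2 \<le> B"
  shows "bounded_operator (\<lambda>x n. complex_of_real (s n) * x (\<sigma> n))"
proof (rule bounded_weighted_composition)
  fix i
  have "{j. \<sigma> j = i} = {inv \<sigma> i}"
    using assms(1) by (auto simp: bij_is_inj bij_is_surj surj_f_inv_f)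
  then show "((\<lambda>j. (s j)\<^sup>2) has_sum (s (inv \<sigma> i))\<^sup>2) {j. \<sigma> j = i}"
    by (auto intro: has_sum_finiteI)
qed (rule assms(2))

text \<open>Reindexing the inner product by \<open>\<sigma>\<close> shows that the adjoint composes
  with the inverse permutation. As \<open>s\<close> is constant along the orbits of
  \<open>\<sigma>\<close>, the adjoint has the same weights, and both products of the two operators
  are multiplication by the square of \<open>s\<close>.\<close>

lemma normal_weighted_permutation:
  fixes \<sigma> :: "'i \<Rightarrow> 'i" and s :: "'i \<Rightarrow> real"
  assumes \<sigma>: "bij \<sigma>" and B: "\<And>n. (s n)\<^sup>2 \<le> B" and inv: "\<And>n. s (\<sigma> n) = s n"
  shows "normal_operator (\<lambda>x n. complex_of_real (s n) * x (\<sigma> n))"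
proof -
  let ?N = "\<lambda>x n. complex_of_real (s n) * x (\<sigma> n)"
  let ?S = "\<lambda>x n. complex_of_real (s n) * x (inv \<sigma> n)"
  have s1: "\<sigma> (inv \<sigma> n) = n" for n
    using \<sigma> by (simp add: bij_is_surj surj_f_inv_f)
  have s2: "inv \<sigma> (\<sigma> n) = n" for n
    using \<sigma> by (simp add: bij_is_inj)
  have s3: "s (inv \<sigma> n) = s n" for n
    using inv[of "inv \<sigma> n"] by (simp add: s1)
  have "l2_inner (?N x) y = l2_inner x (?S y)" for x y
  proof -
    have "l2_inner x (?S y) = (\<Sum>\<^sub>\<infinity>n. x (\<sigma> n) * cnj (?S y (\<sigma> n)))"
      unfolding l2_inner_def by (rule infsum_reindex_bij_betw[OF \<sigma>, symmetric])
    then show ?thesis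
      unfolding l2_inner_def by (simp add: s2 inv mult_ac)
  qed
  then have "adjoint_pair ?N ?S"
    by (simp add: adjoint_pair_def)
  moreover have "?N (?S x) = ?S (?N x)" for x
    by (simp add: s1 s2 s3 inv)
  ultimately show ?thesis
    unfolding normal_operator_def
    using bounded_weighted_permutation[of \<sigma> s B, OF \<sigma> B]
      bounded_weighted_permutation[of "inv \<sigma>" s B, OF bij_imp_bij_inv[OF \<sigma>] B]
    by (intro conjI exI[of _ ?S]) auto
qed

text \<open>The shift is a weighted composition with the predecessor map. Since
  \<open>0 - 1 = 0\<close> on the naturals, the fibre over 0 is \<open>{0, 1}\<close>; the weight 0
  at index 0 discards the extra point and makes the first coordinate vanish.\<close>

lemma bounded_weighted_shift:
  assumes "\<And>n. (\<alpha> n)\<^sup>2 \<le> B"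
  shows "bounded_operator (weighted_shift \<alpha>)"
proof -
  define w where "w = (\<lambda>n. case n of 0 \<Rightarrow> 0 | Suc j \<Rightarrow> \<alpha> j)"
  have "((\<lambda>j. (w j)\<^sup>2) has_sum (\<alpha> i)\<^sup>2) {j. j - 1 = i}" for i
  proof -
    have "((\<lambda>j. (w j)\<^sup>2) has_sum (\<alpha> i)\<^sup>2) {Suc i}"
      by (rule has_sum_finiteI) (auto simp: w_def)
    then show ?thesis
      by (rule has_sum_cong_neutral[THEN iffD1, rotated -1])
         (auto simp: w_def split: nat.splits)
  qed
  then have "bounded_operator (\<lambda>x j. complex_of_real (w j) * x (j - 1))"
    using assms by (rule bounded_weighted_composition)
  moreover have "weighted_shift \<alpha> = (\<lambda>x j. complex_of_real (w j) * x (j - 1))"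
    by (auto simp: weighted_shift_def w_def fun_eq_iff split: nat.splits)
  ultimately show ?thesis
    by simp
qed

section \<open>The normal extension of the shift of a positive atomic measure\<close>

text \<open>Serves to bound the squared weights of the shift by any upper bound of the
  atoms.\<close>

lemma atomic_moment_Suc_le:
  assumes "(\<lambda>i. a i * r i ^ n) summable_on I" and "(\<lambda>i. a i * r i ^ Suc n) summable_on I"
    and "\<And>i. i \<in> I \<Longrightarrow> 0 \<le> a i" and "\<And>i. i \<in> I \<Longrightarrow> 0 \<le> r i \<and> r i \<le> R"
  shows "atomic_moment I a r (Suc n) \<le> R * atomic_moment I a r n"
proof -
  have "atomic_moment I a r (Suc n) \<le> (\<Sum>\<^sub>\<infinity>i\<in>I. R * (a i * r i ^ n))"
    unfolding atomic_moment_def using assms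
    by (intro infsum_mono summable_on_cmult_right)
       (auto simp: mult.left_commute[of R] intro!: mult_left_mono mult_right_mono)
  then show ?thesis
    by (simp add: atomic_moment_def infsum_cmult_right[OF assms(1)])
qed

text \<open>
  The normal extension is multiplication by \<open>z\<close> on \<open>L\<^sup>2(\<nu>)\<close>, where \<open>\<nu>\<close> carries the mass
  \<open>a i\<close> spread uniformly over the circle of radius \<open>sqrt (r i)\<close>. In the Fourier basis this is a
  direct sum of scaled bilateral shifts, indexed by \<open>I \<times> UNIV\<close>, which is enumerated by \<open>e\<close>.
\<close>

lemma subnormal_atomic_shift:
  fixes I :: "'i set" and a r :: "'i \<Rightarrow> real" and \<gamma> :: "nat \<Rightarrow> real"
  assumes I: "countable I"
    and a: "\<And>i. i \<in> I \<Longrightarrow> 0 \<le> a i" and r: "\<And>i. i \<in> I \<Longrightarrow> 0 \<le> r i \<and> r i \<le> R"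
    and sum: "\<And>n. ((\<lambda>i. a i * r i ^ n) has_sum \<gamma> n) I" and pos: "\<And>n. 0 < \<gamma> n"
  shows "subnormal (weighted_shift (\<lambda>n. sqrt (\<gamma> (Suc n) / \<gamma> n)))"
proof -
  let ?\<alpha> = "\<lambda>n. sqrt (\<gamma> (Suc n) / \<gamma> n)"
  let ?J = "I \<times> (UNIV :: int set)"
  have "I \<noteq> {}"
    using infsumI[OF sum[of 0]] pos[of 0] by auto
  then obtain i0 where i0: "i0 \<in> I" by auto
  \<comment> \<open>Infinitely many frequencies over a nonempty \<open>I\<close> make the index set
    countably infinite even for finite \<open>I\<close>, so it can be enumerated by all
    naturals.\<close>
  have "infinite ?J"
    using \<open>I \<noteq> {}\<close> by (auto dest!: finite_cartesian_productD2 simp: infinite_UNIV_int)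
  moreover have "countable ?J"
    using I by auto
  ultimately obtain e :: "nat \<Rightarrow> 'i \<times> int" where e: "bij_betw e UNIV ?J"
    using bij_betw_from_nat_into by blast
  define d where "d = the_inv_into UNIV e"
  have ed: "e (d p) = p" if "p \<in> ?J" for p
    unfolding d_def using that e by (simp add: f_the_inv_into_f_bij_betw)
  have de: "d (e n) = n" for n
    unfolding d_def using e by (simp add: bij_betw_def the_inv_into_f_f)
  have eI: "fst (e n) \<in> I" for n
    using bij_betwE[OF e] by (auto simp: mem_Times_iff)
  \<comment> \<open>Multiplication by \<open>z\<close> raises the frequency by one, so the new
    coefficient at frequency \<open>k\<close> is read off from frequency \<open>k - 1\<close> on the
    same circle.\<close>
  define \<sigma> where "\<sigma> n = d (fst (e n), snd (e n) - 1)" for n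
  define s where "s n = sqrt (r (fst (e n)))" for n
  \<comment> \<open>\<open>f\<close> and \<open>w\<close> encode the embedding that sends the
    \<open>m\<close>-th basis vector to \<open>z ^ m\<close> divided by its norm. The circle
    belonging to \<open>i\<close> contributes \<open>a i * r i ^ m\<close> to the squared norm of
    \<open>z ^ m\<close>, with total \<open>\<gamma> m\<close>. Negative frequencies, which
    \<open>nat\<close> maps to 0, receive weight 0.\<close>
  define f where "f n = nat (snd (e n))" for n
  define w where "w n = (if snd (e n) < 0 then 0 else
      sqrt (a (fst (e n)) * r (fst (e n)) ^ f n / \<gamma> (f n)))" for n
  have e\<sigma>: "e (\<sigma> n) = (fst (e n), snd (e n) - 1)" for n
    unfolding \<sigma>_def using eI by (simp add: ed)
  have "bij \<sigma>"
    by (rule bij_betw_byWitness[where f' = "\<lambda>n. d (fst (e n), snd (e n) + 1)"])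
       (auto simp: e\<sigma> ed eI \<sigma>_def de)
  moreover have "(s n)\<^sup>2 \<le> R" for n
    using r[OF eI[of n]] by (simp add: s_def)
  moreover have "s (\<sigma> n) = s n" for n
    by (simp add: s_def e\<sigma>)
  ultimately have N: "normal_operator (\<lambda>x n. complex_of_real (s n) * x (\<sigma> n))"
    by (rule normal_weighted_permutation)
  have w: "((\<lambda>n. (w n)\<^sup>2) has_sum 1) {n. f n = m}" for m
  proof -
    have b: "bij_betw (\<lambda>i. d (i, int m)) I {n. snd (e n) = int m}"
      by (rule bij_betw_byWitness[where f' = "\<lambda>n. fst (e n)"])
         (auto simp: ed eI, metis de prod.collapse)
    have "((\<lambda>i. a i * r i ^ m / \<gamma> m) has_sum \<gamma> m / \<gamma> m) I"
      using has_sum_cmult_left[OF sum[of m], of "inverse (\<gamma> m)"] by (simp only: divide_inverse)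
    then have "((\<lambda>i. a i * r i ^ m / \<gamma> m) has_sum 1) I"
      using pos[of m] by simp
    then have "((\<lambda>i. (w (d (i, int m)))\<^sup>2) has_sum 1) I"
      by (rule has_sum_cong[THEN iffD1, rotated])
         (use pos[of m] a r in \<open>auto simp: w_def f_def ed less_imp_le\<close>)
    then have "((\<lambda>n. (w n)\<^sup>2) has_sum 1) {n. snd (e n) = int m}"
      by (simp add: has_sum_reindex_bij_betw[OF b, of "\<lambda>n. (w n)\<^sup>2"])
    \<comment> \<open>The negative frequencies also lie in the fibre of \<open>f\<close> over 0, but
      \<open>w\<close> vanishes there.\<close>
    then show ?thesis
      by (rule has_sum_cong_neutral[THEN iffD1, rotated -1]) (auto simp: f_def w_def)
  qed
  have V: "bounded_operator (\<lambda>x n. complex_of_real (w n) * x (f n))"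
    by (rule bounded_weighted_composition[OF w order.refl])
  have "(\<gamma> (Suc n) / \<gamma> n) \<le> R" for n
    using atomic_moment_Suc_le[OF has_sum_imp_summable[OF sum] has_sum_imp_summable[OF sum] a r]
      pos[of n] infsumI[OF sum] by (simp add: atomic_moment_def divide_le_eq del: power_Suc)
  then have "bounded_operator (weighted_shift ?\<alpha>)"
    using pos by (intro bounded_weighted_shift[of _ R]) (simp add: less_imp_le)
  \<comment> \<open>This is the intertwining relation in coordinates. At frequencies up to 0 both
    sides vanish: the lowered frequency is negative, and on the right either \<open>w n\<close> is 0
    or the shift contributes its zero coordinate.\<close>
  moreover have "complex_of_real (s n) * (complex_of_real (w (\<sigma> n)) * X (f (\<sigma> n))) =
      complex_of_real (w n) * weighted_shift ?\<alpha> X (f n)" for n X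
  proof (cases "snd (e n) \<le> 0")
    case True
    then show ?thesis
      by (auto simp: w_def e\<sigma> f_def weighted_shift_def)
  next
    case False
    define m where "m = nat (snd (e n) - 1)"
    have m: "snd (e n) = int (Suc m)"
      using False by (simp add: m_def)
    let ?i = "fst (e n)"
    have "s n * w (\<sigma> n) = sqrt (r ?i * (a ?i * r ?i ^ m / \<gamma> m))"
      by (simp add: s_def w_def e\<sigma> f_def m real_sqrt_mult[symmetric])
    \<comment> \<open>The quotient of the squared norms of \<open>z ^ Suc m\<close> and
      \<open>z ^ m\<close> is the squared shift weight.\<close>
    also have "\<dots> = sqrt ((a ?i * r ?i ^ Suc m / \<gamma> (Suc m)) * (\<gamma> (Suc m) / \<gamma> m))"
      using pos[of "Suc m"] by (simp add: field_simps)
    also have "\<dots> = w n * ?\<alpha> m"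
      unfolding real_sqrt_mult by (simp add: w_def f_def m del: of_nat_Suc)
    finally have *: "complex_of_real (s n) * complex_of_real (w (\<sigma> n)) = complex_of_real (w n) * complex_of_real (?\<alpha> m)"
      by (metis of_real_mult)
    have "f (\<sigma> n) = m" "f n = Suc m"
      by (auto simp: f_def e\<sigma> m)
    then show ?thesis
      using * by (simp add: weighted_shift_def mult.assoc[symmetric])
  qed
  ultimately show ?thesis
    unfolding subnormal_def
    using N V isometric_weighted_composition[OF w]
    by - (rule conjI, assumption, rule exI[of _ "\<lambda>x n. complex_of_real (s n) * x (\<sigma> n)"],
       rule exI[of _ "\<lambda>x n. complex_of_real (w n) * x (f n)"], simp)
qed


section \<open>Moments of atomic measures\<close>

lemma abs_summable_mult_bounded:
  fixes b g :: "'i \<Rightarrow> real"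
  assumes "(\<lambda>i. \<bar>b i\<bar>) summable_on I" and "\<And>i. i \<in> I \<Longrightarrow> \<bar>g i\<bar> \<le> B"
  shows "(\<lambda>i. \<bar>b i * g i\<bar>) summable_on I"
  using summable_on_cmult_left[OF assms(1), of B]
  by (rule summable_on_comparison_test) (auto simp: abs_mult intro!: mult_left_mono assms(2))

lemma abs_summable_imp_summable_real:
  fixes b :: "'i \<Rightarrow> real"
  assumes "(\<lambda>i. \<bar>b i\<bar>) summable_on I"
  shows "b summable_on I"
  using assms summable_on_iff_abs_summable_on_real[of b I] by simp

lemma infsum_eq_integral_count_space:
  fixes b :: "'i \<Rightarrow> real"
  assumes "(\<lambda>i. \<bar>b i\<bar>) summable_on I"
  shows "integrable (count_space I) b" and "(\<Sum>\<^sub>\<infinity>i\<in>I. b i) = (\<integral>i. b i \<partial>count_space I)"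
proof -
  have "Infinite_Set_Sum.abs_summable_on b I"
    using assms by (simp add: abs_summable_equivalent[symmetric])
  then show "integrable (count_space I) b" "(\<Sum>\<^sub>\<infinity>i\<in>I. b i) = (\<integral>i. b i \<partial>count_space I)"
    using infsetsum_infsum[of b I] by (auto simp: Infinite_Set_Sum.abs_summable_on_def infsetsum_def)
qed

text \<open>Lebesgue dominated convergence for the counting measure on \<open>I\<close>, with
  majorant \<open>\<bar>b i\<bar>\<close>. It lets a limit pass through the sum when there are
  infinitely many atoms.\<close>

lemma infsum_dominated_convergence:
  fixes b :: "'i \<Rightarrow> real" and g :: "nat \<Rightarrow> 'i \<Rightarrow> real"
  assumes b: "(\<lambda>i. \<bar>b i\<bar>) summable_on I" and g: "\<And>m i. i \<in> I \<Longrightarrow> \<bar>g m i\<bar> \<le> 1"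
    and lim: "\<And>i. i \<in> I \<Longrightarrow> (\<lambda>m. g m i) \<longlonglongrightarrow> h i"
  shows "(\<lambda>m. \<Sum>\<^sub>\<infinity>i\<in>I. b i * g m i) \<longlonglongrightarrow> (\<Sum>\<^sub>\<infinity>i\<in>I. b i * h i)"
proof -
  have h: "\<bar>h i\<bar> \<le> 1" if "i \<in> I" for i
    using tendsto_rabs[OF lim[OF that]] by (rule LIMSEQ_le_const2) (use g that in auto)
  have "(\<lambda>m. \<integral>i. b i * g m i \<partial>count_space I) \<longlonglongrightarrow> (\<integral>i. b i * h i \<partial>count_space I)"
  proof (rule integral_dominated_convergence[where w = "\<lambda>i. \<bar>b i\<bar>"])
    show "integrable (count_space I) (\<lambda>i. \<bar>b i\<bar>)"
      by (rule infsum_eq_integral_count_space) (use b in simp)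
    show "AE i in count_space I. (\<lambda>m. b i * g m i) \<longlonglongrightarrow> b i * h i"
      by (auto simp: AE_count_space intro!: tendsto_mult lim)
    show "AE i in count_space I. norm (b i * g m i) \<le> \<bar>b i\<bar>" for m
      using g by (auto simp: AE_count_space abs_mult mult_left_le)
  qed auto
  then show ?thesis
    using infsum_eq_integral_count_space(2)[OF abs_summable_mult_bounded[OF b g]]
      infsum_eq_integral_count_space(2)[OF abs_summable_mult_bounded[OF b h]]
    by simp
qed

section \<open>Testing moments against polynomials\<close>

lemma integrable_power_compact_support:
  assumes "finite_measure \<rho>" and "sets \<rho> = sets borel" and "AE t in \<rho>. \<bar>t\<bar> \<le> R"
  shows "integrable \<rho> (\<lambda>t::real. t ^ n)"
proof -
  interpret finite_measure \<rho> by fact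
  have "AE t in \<rho>. norm (t ^ n) \<le> R ^ n"
    using assms(3) by eventually_elim (auto simp: power_abs intro: power_mono)
  moreover have "(\<lambda>t::real. t ^ n) \<in> borel_measurable \<rho>"
    using assms(2) by (simp add: measurable_cong_sets[OF assms(2) refl])
  ultimately show ?thesis
    by (rule integrable_const_bound)
qed

lemma has_sum_finite_sum:
  fixes f :: "'n \<Rightarrow> 'i \<Rightarrow> 'b :: topological_comm_monoid_add"
  assumes "\<And>n. n \<in> F \<Longrightarrow> (f n has_sum S n) I"
  shows "((\<lambda>i. \<Sum>n\<in>F. f n i) has_sum (\<Sum>n\<in>F. S n)) I"
  using assms by (induction F rule: infinite_finite_induct) (auto intro!: has_sum_add)

text \<open>Linearity carries agreement of the moments over to polynomials, which are the test
  functions used to isolate an atom.\<close>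

lemma integral_poly_eq_infsum:
  fixes b s :: "'i \<Rightarrow> real" and p :: "real poly"
  assumes int: "\<And>n. integrable \<rho> (\<lambda>t::real. t ^ n)" and sum: "\<And>n. (\<lambda>i. b i * s i ^ n) summable_on I"
    and mom: "\<And>n. (\<integral>t. t ^ n \<partial>\<rho>) = (\<Sum>\<^sub>\<infinity>i\<in>I. b i * s i ^ n)"
  shows "(\<integral>t. poly p t \<partial>\<rho>) = (\<Sum>\<^sub>\<infinity>i\<in>I. b i * poly p (s i))"
proof -
  have "(\<Sum>\<^sub>\<infinity>i\<in>I. b i * poly p (s i)) = (\<Sum>\<^sub>\<infinity>i\<in>I. \<Sum>n\<le>degree p. coeff p n * (b i * s i ^ n))"
    by (simp add: poly_altdef sum_distrib_left mult_ac)
  also have "\<dots> = (\<Sum>n\<le>degree p. \<Sum>\<^sub>\<infinity>i\<in>I. coeff p n * (b i * s i ^ n))"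
    by (intro infsumI has_sum_finite_sum has_sum_infsum summable_on_cmult_right sum)
  also have "\<dots> = (\<Sum>n\<le>degree p. coeff p n * (\<integral>t. t ^ n \<partial>\<rho>))"
    by (simp add: mom infsum_cmult_right[OF sum])
  also have "\<dots> = (\<integral>t. poly p t \<partial>\<rho>)"
    by (simp add: poly_altdef int)
  finally show ?thesis by simp
qed

text \<open>
  The polynomials \<open>(1 - ((t - x) / R)\<^sup>2) ^ m\<close> are nonnegative on \<open>[0, R]\<close> and decrease there to
  the indicator of \<open>x\<close>, so their integrals converge to the density of the atom at \<open>x\<close>.
\<close>

lemma atom_nonneg_of_moments:
  fixes b s :: "'i \<Rightarrow> real"
  assumes b: "(\<lambda>i. \<bar>b i\<bar>) summable_on I" and s: "\<And>i. i \<in> I \<Longrightarrow> 0 \<le> s i" "bounded (s ` I)"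
    and inj: "inj_on s I"
    and \<rho>: "sets \<rho> = sets borel" "finite_measure \<rho>" "compactly_supported_nonneg \<rho>"
    and mom: "\<And>n. (\<integral>t. t ^ n \<partial>\<rho>) = (\<Sum>\<^sub>\<infinity>i\<in>I. b i * s i ^ n)"
    and k: "k \<in> I"
  shows "0 \<le> b k"
proof -
  obtain R1 where R1: "emeasure \<rho> (- {0..R1}) = 0"
    using \<rho>(3) by (auto simp: compactly_supported_nonneg_def)
  obtain R2 where R2: "\<And>i. i \<in> I \<Longrightarrow> \<bar>s i\<bar> \<le> R2"
    using s(2) by (auto simp: bounded_iff)
  \<comment> \<open>A common bound for the support of \<open>\<rho>\<close> and for the atoms; the
    maximum with 1 makes it positive, so that division by it is possible.\<close>
  define R where "R = max 1 (max R1 R2)"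
  have "R > 0" by (simp add: R_def)
  have ae: "AE t in \<rho>. 0 \<le> t \<and> t \<le> R"
  proof (rule AE_I[where N = "- {0..R1}"])
    show "- {0..R1} \<in> sets \<rho>" by (simp add: \<rho>(1))
  qed (auto simp: R1 R_def)
  have sR: "0 \<le> s i \<and> s i \<le> R" if "i \<in> I" for i
    using R2[OF that] s(1)[OF that] by (auto simp: R_def)
  have sum: "(\<lambda>i. b i * s i ^ n) summable_on I" for n
    by (rule abs_summable_imp_summable_real, rule abs_summable_mult_bounded[OF b, of _ "R ^ n"])
       (use sR in \<open>auto simp: power_abs intro!: power_mono\<close>)
  have int: "integrable \<rho> (\<lambda>t. t ^ n)" for n
    by (rule integrable_power_compact_support[OF \<rho>(2,1), of R]) (use ae in eventually_elim, auto)
  define q where "q = [:1 - (s k / R)\<^sup>2, 2 * s k / R\<^sup>2, - (1 / R\<^sup>2):]"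
  have q: "poly q t = 1 - ((t - s k) / R)\<^sup>2" for t
    by (simp add: q_def power2_eq_square diff_divide_distrib algebra_simps add_divide_distrib)
  have q01: "0 \<le> poly q t" "poly q t \<le> 1" if "0 \<le> t \<and> t \<le> R" for t
  proof -
    have "\<bar>(t - s k) / R\<bar> \<le> 1"
      using that sR[OF k] \<open>R > 0\<close> by (auto simp: abs_le_iff field_simps)
    then show "0 \<le> poly q t" "poly q t \<le> 1"
      by (auto simp: q abs_square_le_1)
  qed
  \<comment> \<open>The sign comes from \<open>\<rho>\<close>: \<open>q ^ m\<close> is nonnegative
    almost everywhere for this positive measure, and agreement of the moments transfers the
    inequality to the signed sum.\<close>
  have "0 \<le> (\<Sum>\<^sub>\<infinity>i\<in>I. b i * poly q (s i) ^ m)" for m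
  proof -
    have "0 \<le> (\<integral>t. poly (q ^ m) t \<partial>\<rho>)"
      by (rule integral_nonneg_AE) (use ae in \<open>eventually_elim, auto intro!: zero_le_power q01\<close>)
    then show ?thesis
      using integral_poly_eq_infsum[OF int sum mom, of "q ^ m"] by (simp only: poly_power)
  qed
  moreover have "(\<lambda>m. \<Sum>\<^sub>\<infinity>i\<in>I. b i * poly q (s i) ^ m) \<longlonglongrightarrow> (\<Sum>\<^sub>\<infinity>i\<in>I. b i * (if i = k then 1 else 0))"
  proof (rule infsum_dominated_convergence[OF b])
    fix i assume i: "i \<in> I"
    show "\<bar>poly q (s i) ^ m\<bar> \<le> 1" for m
      using q01[OF sR[OF i]] by (simp add: power_abs power_le_one)
    show "(\<lambda>m. poly q (s i) ^ m) \<longlonglongrightarrow> (if i = k then 1 else 0)"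
    proof (cases "i = k")
      case True
      then show ?thesis by (simp add: q)
    next
      case False
      then have "s i \<noteq> s k"
        using inj i k by (auto dest: inj_onD)
      then have "poly q (s i) < 1"
        using \<open>R > 0\<close> by (simp add: q)
      then show ?thesis
        using False q01[OF sR[OF i]] by (auto intro!: LIMSEQ_power_zero)
    qed
  qed
  ultimately have "0 \<le> (\<Sum>\<^sub>\<infinity>i\<in>I. b i * (if i = k then 1 else 0))"
    by (intro LIMSEQ_le_const) auto
  also have "\<dots> = (\<Sum>\<^sub>\<infinity>i\<in>{k}. b i)"
    using k by (intro infsum_cong_neutral) auto
  finally show ?thesis by simp
qed

text \<open>Take the push-forward under \<open>s\<close> of the counting measure on \<open>I\<close>
  with density \<open>b\<close>. It supplies the representing measure when the second differences
  have densities of one weak sign.\<close>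

lemma atomic_measure_exists:
  fixes b s :: "'i \<Rightarrow> real"
  assumes b: "b summable_on I" "\<And>i. i \<in> I \<Longrightarrow> 0 \<le> b i"
    and s: "\<And>i. i \<in> I \<Longrightarrow> 0 \<le> s i" "bounded (s ` I)"
  obtains \<rho> :: "real measure" where "sets \<rho> = sets borel" "finite_measure \<rho>"
    "compactly_supported_nonneg \<rho>" "\<And>n. (\<integral>t. t ^ n \<partial>\<rho>) = (\<Sum>\<^sub>\<infinity>i\<in>I. b i * s i ^ n)"
proof -
  define \<rho> where "\<rho> = distr (density (count_space I) b) borel s"
  have babs: "(\<lambda>i. \<bar>b i\<bar>) summable_on I"
    using b by (simp cong: summable_on_cong)
  have sets: "sets \<rho> = sets borel"
    by (simp add: \<rho>_def)
  have meas: "s \<in> measurable (density (count_space I) b) borel"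
    by simp
  obtain R where R: "\<And>i. i \<in> I \<Longrightarrow> \<bar>s i\<bar> \<le> R"
    using s(2) by (auto simp: bounded_iff)
  have "emeasure \<rho> UNIV = (\<integral>\<^sup>+i. b i \<partial>count_space I)"
    unfolding \<rho>_def by (subst emeasure_distr) (auto simp: emeasure_density intro!: nn_integral_cong)
  also have "\<dots> = ennreal (\<integral>i. b i \<partial>count_space I)"
    by (rule nn_integral_eq_integral[OF infsum_eq_integral_count_space(1)[OF babs]])
       (simp add: AE_count_space b)
  finally have "finite_measure \<rho>"
    by (intro finite_measureI) (simp add: \<rho>_def)
  moreover have "compactly_supported_nonneg \<rho>"
  proof -
    have "s -` (- {0..R}) \<inter> I = {}"
      using R s(1) by (force simp: abs_le_iff)
    then have "emeasure \<rho> (- {0..R}) = 0"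
      unfolding \<rho>_def by (subst emeasure_distr) auto
    then show ?thesis
      by (auto simp: compactly_supported_nonneg_def)
  qed
  moreover have "(\<integral>t. t ^ n \<partial>\<rho>) = (\<Sum>\<^sub>\<infinity>i\<in>I. b i * s i ^ n)" for n
  proof -
    have "(\<integral>t. t ^ n \<partial>\<rho>) = (\<integral>i. b i * s i ^ n \<partial>count_space I)"
      unfolding \<rho>_def by (subst integral_distr[OF meas]) (auto simp: integral_density AE_count_space b)
    also have "\<dots> = (\<Sum>\<^sub>\<infinity>i\<in>I. b i * s i ^ n)"
      by (rule infsum_eq_integral_count_space(2)[symmetric],
          rule abs_summable_mult_bounded[OF babs, of _ "R ^ n"])
         (use R in \<open>auto simp: power_abs intro!: power_mono\<close>)
    finally show ?thesis .
  qed
  ultimately show ?thesis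
    by (rule that[OF sets])
qed


section \<open>Multipliers producing CPD-weights\<close>

text \<open>The two signs permitted in \<open>CPD_weights\<close> correspond to the two disjuncts. A
  representing measure forces the sign of every density by \<open>atom_nonneg_of_moments\<close>;
  conversely, densities of one weak sign give a measure by
  \<open>atomic_measure_exists\<close>.\<close>

lemma CPD_weights_scaled_iff:
  fixes I :: "'i set" and a r :: "'i \<Rightarrow> real" and \<gamma> \<alpha> :: "nat \<Rightarrow> real"
  assumes at: "countably_atomic I a r"
    and r0: "\<forall>i\<in>I. 0 \<le> r i"
    and \<gamma>: "\<forall>n. \<gamma> n = atomic_moment I a r n"
    and pos: "\<forall>n. \<gamma> n \<noteq> 0 \<and> 0 < \<gamma> (Suc n) / \<gamma> n"
    and \<alpha>: "\<forall>n. \<alpha> n = sqrt (\<gamma> (Suc n) / \<gamma> n)"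
    and c: "0 < c"
  shows "CPD_weights (\<lambda>n. c * \<alpha> n) \<longleftrightarrow>
    (\<forall>i\<in>I. c\<^sup>2 * r i = 1 \<or> 0 < a i) \<or> (\<forall>i\<in>I. c\<^sup>2 * r i = 1 \<or> a i < 0)"
proof -
  have inj: "inj_on r I" and a0: "\<forall>i\<in>I. a i \<noteq> 0" and asum: "(\<lambda>i. \<bar>a i\<bar>) summable_on I"
    and bdd: "bounded (r ` I)"
    using at by (auto simp: countably_atomic_def)
  obtain R where R: "\<And>i. i \<in> I \<Longrightarrow> \<bar>r i\<bar> \<le> R"
    using bdd by (auto simp: bounded_iff)
  have sum: "(\<lambda>i. a i * r i ^ n) summable_on I" for n
    by (rule abs_summable_imp_summable_real, rule abs_summable_mult_bounded[OF asum, of _ "R ^ n"])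
       (use R in \<open>auto simp: power_abs intro!: power_mono\<close>)
  define s where "s i = c\<^sup>2 * r i" for i
  \<comment> \<open>The density of the second difference: differencing \<open>s i ^ n\<close> twice
    gives the factor \<open>(s i - 1)\<^sup>2\<close>, and dividing by \<open>\<gamma> 0\<close>
    normalises the moments to start with 1.\<close>
  define b where "b i = a i * ((s i - 1)\<^sup>2 / \<gamma> 0)" for i
  have s: "0 \<le> s i" if "i \<in> I" for i
    using r0 that by (simp add: s_def)
  have sR: "\<bar>s i\<bar> \<le> c\<^sup>2 * R" if "i \<in> I" for i
    using R[OF that] by (simp add: s_def abs_mult mult_left_mono)
  have bdds: "bounded (s ` I)"
    using sR by (auto simp: bounded_iff)
  have injs: "inj_on s I"
    using inj c by (auto simp: inj_on_def s_def)
  have bsum: "(\<lambda>i. \<bar>b i\<bar>) summable_on I"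
    unfolding b_def
  proof (rule abs_summable_mult_bounded[OF asum])
    fix i assume i: "i \<in> I"
    have "\<bar>s i - 1\<bar> \<le> c\<^sup>2 * R + 1"
      using sR[OF i] by linarith
    then have "\<bar>s i - 1\<bar>\<^sup>2 \<le> (c\<^sup>2 * R + 1)\<^sup>2"
      by (rule power_mono) simp
    then show "\<bar>(s i - 1)\<^sup>2 / \<gamma> 0\<bar> \<le> (c\<^sup>2 * R + 1)\<^sup>2 / \<bar>\<gamma> 0\<bar>"
      by (simp add: divide_right_mono)
  qed
  have mom: "shift_moment (\<lambda>n. c * \<alpha> n) n = (\<Sum>\<^sub>\<infinity>i\<in>I. a i * s i ^ n) / \<gamma> 0" for n
  proof -
    \<comment> \<open>The product of the squared weights telescopes; the ratios are positive, so
      squaring \<open>\<alpha> n\<close> recovers them.\<close>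
    have "shift_moment (\<lambda>n. c * \<alpha> n) n = (c\<^sup>2) ^ n * \<gamma> n / \<gamma> 0"
      by (induction n)
         (use pos in \<open>auto simp: shift_moment_def \<alpha> power_mult_distrib less_imp_le\<close>)
    also have "(c\<^sup>2) ^ n * \<gamma> n = (\<Sum>\<^sub>\<infinity>i\<in>I. (c\<^sup>2) ^ n * (a i * r i ^ n))"
      by (simp add: \<gamma> atomic_moment_def infsum_cmult_right[OF sum])
    also have "\<dots> = (\<Sum>\<^sub>\<infinity>i\<in>I. a i * s i ^ n)"
      by (simp add: s_def power_mult_distrib mult_ac)
    finally show ?thesis .
  qed
  have ssum: "(\<lambda>i. a i * s i ^ n) summable_on I" for n
    using summable_on_cmult_right[OF sum[of n], of "(c\<^sup>2) ^ n"]
    by (simp add: s_def power_mult_distrib mult_ac)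
  have D: "fdiff (fdiff (shift_moment (\<lambda>n. c * \<alpha> n))) n = (\<Sum>\<^sub>\<infinity>i\<in>I. b i * s i ^ n)" for n
  proof -
    have "((\<lambda>i. (a i * s i ^ Suc (Suc n) + (- 2) * (a i * s i ^ Suc n) + a i * s i ^ n)
             * inverse (\<gamma> 0)) has_sum
          ((\<Sum>\<^sub>\<infinity>i\<in>I. a i * s i ^ Suc (Suc n)) + (- 2) * (\<Sum>\<^sub>\<infinity>i\<in>I. a i * s i ^ Suc n) +
            (\<Sum>\<^sub>\<infinity>i\<in>I. a i * s i ^ n)) * inverse (\<gamma> 0)) I"
      by (intro has_sum_cmult_left has_sum_cmult_right has_sum_add has_sum_infsum ssum)
    from infsumI[OF this] show ?thesis
      by (simp add: fdiff_def mom b_def power2_eq_square divide_inverse algebra_simps)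
  qed
  have b_iff: "0 \<le> b i \<longleftrightarrow> s i = 1 \<or> 0 < a i / \<gamma> 0" "b i \<le> 0 \<longleftrightarrow> s i = 1 \<or> a i / \<gamma> 0 < 0"
    if "i \<in> I" for i
  proof -
    \<comment> \<open>With a nonzero factor, a weak sign of the product means that the square
      vanishes or the factor has that sign strictly.\<close>
    have sq: "0 \<le> x * y\<^sup>2 \<longleftrightarrow> y = 0 \<or> 0 < x" "x * y\<^sup>2 \<le> 0 \<longleftrightarrow> y = 0 \<or> x < 0" if "x \<noteq> 0" for x y :: real
      using that by (auto simp: zero_le_mult_iff mult_le_0_iff)
    have b: "b i = a i / \<gamma> 0 * (s i - 1)\<^sup>2"
      by (simp add: b_def)
    have nz: "a i / \<gamma> 0 \<noteq> 0"
      using a0 that pos by auto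
    show "0 \<le> b i \<longleftrightarrow> s i = 1 \<or> 0 < a i / \<gamma> 0" "b i \<le> 0 \<longleftrightarrow> s i = 1 \<or> a i / \<gamma> 0 < 0"
      by (simp_all only: b sq[OF nz] right_minus_eq)
  qed
  have "CPD_weights (\<lambda>n. c * \<alpha> n) \<longleftrightarrow> (\<forall>i\<in>I. 0 \<le> b i) \<or> (\<forall>i\<in>I. b i \<le> 0)"
  proof
    assume "CPD_weights (\<lambda>n. c * \<alpha> n)"
    then obtain \<rho> :: "real measure" where
      \<rho>: "sets \<rho> = sets borel" "finite_measure \<rho>" "compactly_supported_nonneg \<rho>"
      and "(\<forall>n. (\<Sum>\<^sub>\<infinity>i\<in>I. b i * s i ^ n) = (\<integral>t. t ^ n \<partial>\<rho>)) \<or>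
           (\<forall>n. (\<Sum>\<^sub>\<infinity>i\<in>I. b i * s i ^ n) = - (\<integral>t. t ^ n \<partial>\<rho>))"
      unfolding CPD_weights_def D by auto
    then show "(\<forall>i\<in>I. 0 \<le> b i) \<or> (\<forall>i\<in>I. b i \<le> 0)"
    proof (elim disjE)
      assume "\<forall>n. (\<Sum>\<^sub>\<infinity>i\<in>I. b i * s i ^ n) = (\<integral>t. t ^ n \<partial>\<rho>)"
      then show ?thesis
        using atom_nonneg_of_moments[OF bsum s bdds injs \<rho>] by simp
    next
      assume *: "\<forall>n. (\<Sum>\<^sub>\<infinity>i\<in>I. b i * s i ^ n) = - (\<integral>t. t ^ n \<partial>\<rho>)"
      have "(\<integral>t. t ^ n \<partial>\<rho>) = (\<Sum>\<^sub>\<infinity>i\<in>I. - b i * s i ^ n)" for n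
        using * by (simp add: infsum_uminus)
      then show ?thesis
        using atom_nonneg_of_moments[of "\<lambda>i. - b i" I s \<rho>] bsum s bdds injs \<rho> by simp
    qed
  next
    assume "(\<forall>i\<in>I. 0 \<le> b i) \<or> (\<forall>i\<in>I. b i \<le> 0)"
    then show "CPD_weights (\<lambda>n. c * \<alpha> n)"
    proof
      assume "\<forall>i\<in>I. 0 \<le> b i"
      then obtain \<rho> :: "real measure" where "sets \<rho> = sets borel" "finite_measure \<rho>"
        "compactly_supported_nonneg \<rho>" "\<And>n. (\<integral>t. t ^ n \<partial>\<rho>) = (\<Sum>\<^sub>\<infinity>i\<in>I. b i * s i ^ n)"
        using atomic_measure_exists[of b I s] abs_summable_imp_summable_real[OF bsum] s bdds by auto
      then show ?thesis
        unfolding CPD_weights_def D by (intro exI[of _ \<rho>]) simp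
    next
      assume "\<forall>i\<in>I. b i \<le> 0"
      then obtain \<rho> :: "real measure" where "sets \<rho> = sets borel" "finite_measure \<rho>"
        "compactly_supported_nonneg \<rho>" "\<And>n. (\<integral>t. t ^ n \<partial>\<rho>) = (\<Sum>\<^sub>\<infinity>i\<in>I. - b i * s i ^ n)"
        using atomic_measure_exists[of "\<lambda>i. - b i" I s]
          abs_summable_imp_summable_real[OF bsum] s bdds by (auto simp: summable_on_uminus)
      then show ?thesis
        unfolding CPD_weights_def D by (intro exI[of _ \<rho>]) (simp add: infsum_uminus)
    qed
  qed
  \<comment> \<open>Dividing by a negative \<open>\<gamma> 0\<close> flips all signs at once, which
    merely swaps the two disjuncts.\<close>
  also have "\<dots> \<longleftrightarrow> (\<forall>i\<in>I. s i = 1 \<or> 0 < a i) \<or> (\<forall>i\<in>I. s i = 1 \<or> a i < 0)"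
  proof (cases "\<gamma> 0 > 0")
    case True
    then show ?thesis
      using b_iff by (simp add: zero_less_divide_iff divide_less_0_iff)
  next
    case False
    then have "\<gamma> 0 < 0"
      using pos by (meson linorder_neqE_linordered_idom)
    then have "0 < a i / \<gamma> 0 \<longleftrightarrow> a i < 0" "a i / \<gamma> 0 < 0 \<longleftrightarrow> 0 < a i" for i
      by (auto simp: zero_less_divide_iff divide_less_0_iff)
    then show ?thesis
      using b_iff by auto
  qed
  finally show ?thesis
    by (simp add: s_def)
qed

text \<open>Multiplying the densities and the moments by the common sign \<open>\<epsilon>\<close>
  leaves all ratios of moments unchanged and reduces to positive densities.\<close>

lemma subnormal_of_constant_sign:
  fixes I :: "'i set" and a r :: "'i \<Rightarrow> real" and \<gamma> \<alpha> :: "nat \<Rightarrow> real"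
  assumes at: "countably_atomic I a r"
    and r0: "\<forall>i\<in>I. 0 \<le> r i"
    and \<gamma>: "\<forall>n. \<gamma> n = atomic_moment I a r n"
    and pos: "\<forall>n. \<gamma> n \<noteq> 0 \<and> 0 < \<gamma> (Suc n) / \<gamma> n"
    and \<alpha>: "\<forall>n. \<alpha> n = sqrt (\<gamma> (Suc n) / \<gamma> n)"
    and sgn: "(\<forall>i\<in>I. 0 < a i) \<or> (\<forall>i\<in>I. a i < 0)"
  shows "subnormal (weighted_shift \<alpha>)"
proof -
  have I: "countable I" and asum: "(\<lambda>i. \<bar>a i\<bar>) summable_on I" and bdd: "bounded (r ` I)"
    using at by (auto simp: countably_atomic_def)
  obtain R where R: "\<And>i. i \<in> I \<Longrightarrow> \<bar>r i\<bar> \<le> R"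
    using bdd by (auto simp: bounded_iff)
  have R': "0 \<le> r i \<and> r i \<le> R" if "i \<in> I" for i
    using R[OF that] r0 that by auto
  define \<epsilon> :: real where "\<epsilon> = (if \<forall>i\<in>I. 0 < a i then 1 else - 1)"
  have \<epsilon>: "\<epsilon> * a i = \<bar>a i\<bar>" if "i \<in> I" for i
    using sgn that by (fastforce simp: \<epsilon>_def)
  have "\<epsilon> \<noteq> 0" by (simp add: \<epsilon>_def)
  have sum: "((\<lambda>i. \<bar>a i\<bar> * r i ^ n) has_sum \<epsilon> * \<gamma> n) I" for n
  proof -
    have "(\<lambda>i. a i * r i ^ n) summable_on I"
      by (rule abs_summable_imp_summable_real, rule abs_summable_mult_bounded[OF asum, of _ "R ^ n"])
         (use R in \<open>auto simp: power_abs intro!: power_mono\<close>)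
    then have "((\<lambda>i. a i * r i ^ n) has_sum \<gamma> n) I"
      using \<gamma> by (simp add: atomic_moment_def)
    then have "((\<lambda>i. \<epsilon> * (a i * r i ^ n)) has_sum \<epsilon> * \<gamma> n) I"
      by (rule has_sum_cmult_right)
    then show ?thesis
      by (rule has_sum_cong[THEN iffD1, rotated]) (simp add: \<epsilon>[symmetric])
  qed
  have "0 \<le> \<epsilon> * \<gamma> n" for n
    using sum[of n] by (rule has_sum_nonneg) (use r0 in auto)
  \<comment> \<open>The signed moments are sums of nonnegative terms and are nonzero by assumption,
    hence strictly positive.\<close>
  then have \<epsilon>\<gamma>: "0 < \<epsilon> * \<gamma> n" for n
    using pos \<open>\<epsilon> \<noteq> 0\<close> by (metis less_eq_real_def mult_eq_0_iff)
  have "subnormal (weighted_shift (\<lambda>n. sqrt ((\<epsilon> * \<gamma> (Suc n)) / (\<epsilon> * \<gamma> n))))"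
    by (rule subnormal_atomic_shift[OF I abs_ge_zero R' sum \<epsilon>\<gamma>])
  moreover have "\<alpha> = (\<lambda>n. sqrt ((\<epsilon> * \<gamma> (Suc n)) / (\<epsilon> * \<gamma> n)))"
    using \<alpha> \<open>\<epsilon> \<noteq> 0\<close> by auto
  ultimately show ?thesis by simp
qed

section \<open>Counting the multipliers that cancel an atom\<close>

lemma square_mult_eq_1_iff:
  fixes c x :: real
  assumes "0 < c" "0 < x"
  shows "c\<^sup>2 * x = 1 \<longleftrightarrow> c = 1 / sqrt x"
proof -
  have "c\<^sup>2 * x = (c * sqrt x)\<^sup>2"
    using assms by (simp add: power_mult_distrib)
  also have "\<dots> = 1 \<longleftrightarrow> c * sqrt x = 1"
    using assms by (smt (verit) mult_pos_pos power2_eq_1_iff real_sqrt_gt_zero)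
  also have "\<dots> \<longleftrightarrow> c = 1 / sqrt x"
    using assms by (simp add: field_simps)
  finally show ?thesis .
qed

theorem theorem3p9:
  fixes I :: "'i set" and a r :: "'i \<Rightarrow> real" and \<gamma> \<alpha> :: "nat \<Rightarrow> real"
  assumes "countably_atomic I a r"
    and "\<forall>i\<in>I. 0 \<le> r i"
    and "\<forall>n. \<gamma> n = atomic_moment I a r n"
    and "\<forall>n. \<gamma> n \<noteq> 0 \<and> 0 < \<gamma> (Suc n) / \<gamma> n"
    and "\<forall>n. \<alpha> n = sqrt (\<gamma> (Suc n) / \<gamma> n)"
  shows
    "((\<forall>i\<in>I. 0 < a i) \<or> (\<forall>i\<in>I. a i < 0) \<longrightarrow>
        subnormal (weighted_shift \<alpha>) \<and> CPD_weights \<alpha>) \<and>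
     (\<forall>p q. I = {p, q} \<and> 0 < a p \<and> a q < 0 \<and> r p \<noteq> 0 \<and> r q \<noteq> 0 \<longrightarrow>
        card {c :: real. 0 < c \<and> CPD_weights (\<lambda>n. c * \<alpha> n)} = 2) \<and>
     (\<forall>p\<in>I. (infinite I \<or> 2 < card I) \<and>
        ((a p < 0 \<and> (\<forall>i\<in>I - {p}. 0 < a i)) \<or> (0 < a p \<and> (\<forall>i\<in>I - {p}. a i < 0))) \<and>
        r p \<noteq> 0 \<longrightarrow>
        (\<exists>!c :: real. 0 < c \<and> CPD_weights (\<lambda>n. c * \<alpha> n))) \<and>
     ((\<exists>p\<in>I. \<exists>q\<in>I. p \<noteq> q \<and> 0 < a p \<and> 0 < a q) \<and>
      (\<exists>p\<in>I. \<exists>q\<in>I. p \<noteq> q \<and> a p < 0 \<and> a q < 0) \<longrightarrow>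
        \<not> (\<exists>c :: real. 0 < c \<and> CPD_weights (\<lambda>n. c * \<alpha> n)))"
proof (intro conjI impI allI ballI)
  note cpd = CPD_weights_scaled_iff[OF assms]
  \<comment> \<open>A multiplier moves at most one atom to 1, because the atoms are
    distinct.\<close>
  have one: "i = j" if "i \<in> I" "j \<in> I" "c\<^sup>2 * r i = 1" "c\<^sup>2 * r j = 1" for i j and c :: real
  proof -
    have "r i = r j"
      using that by (metis mult_cancel_left mult_zero_left zero_neq_one)
    then show ?thesis
      using assms(1) that by (auto simp: countably_atomic_def dest: inj_onD)
  qed
  {
    assume sgn: "(\<forall>i\<in>I. 0 < a i) \<or> (\<forall>i\<in>I. a i < 0)"
    show "subnormal (weighted_shift \<alpha>)"
      by (rule subnormal_of_constant_sign[OF assms sgn])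
    show "CPD_weights \<alpha>"
      using sgn cpd[of 1] by auto
  }
  {
    fix p q assume pq: "I = {p, q} \<and> 0 < a p \<and> a q < 0 \<and> r p \<noteq> 0 \<and> r q \<noteq> 0"
    then have "0 < r p" "0 < r q" "p \<noteq> q"
      using assms(2) by auto
    have "0 < c \<and> CPD_weights (\<lambda>n. c * \<alpha> n) \<longleftrightarrow> c = 1 / sqrt (r p) \<or> c = 1 / sqrt (r q)" for c
    proof (cases "0 < c")
      case True
      \<comment> \<open>With one density of each sign, the criterion holds exactly when one of the
        two atoms is cancelled; the two atoms yield different multipliers.\<close>
      have "CPD_weights (\<lambda>n. c * \<alpha> n) \<longleftrightarrow> c\<^sup>2 * r p = 1 \<or> c\<^sup>2 * r q = 1"
        using pq by (auto simp: cpd[OF True])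
      then show ?thesis
        using True \<open>0 < r p\<close> \<open>0 < r q\<close> by (simp add: square_mult_eq_1_iff)
    next
      case False
      then show ?thesis
        using \<open>0 < r p\<close> \<open>0 < r q\<close> by auto
    qed
    then have "{c. 0 < c \<and> CPD_weights (\<lambda>n. c * \<alpha> n)} = {1 / sqrt (r p), 1 / sqrt (r q)}"
      by auto
    moreover have "r p \<noteq> r q"
      using assms(1) pq \<open>p \<noteq> q\<close> by (auto simp: countably_atomic_def)
    ultimately show "card {c. 0 < c \<and> CPD_weights (\<lambda>n. c * \<alpha> n)} = 2"
      by simp
  }
  {
    fix p assume p: "p \<in> I" and *: "(infinite I \<or> 2 < card I) \<and>
        ((a p < 0 \<and> (\<forall>i\<in>I - {p}. 0 < a i)) \<or> (0 < a p \<and> (\<forall>i\<in>I - {p}. a i < 0))) \<and> r p \<noteq> 0"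
    have "0 < r p"
      using * p assms(2) by (metis order_le_less)
    \<comment> \<open>With more than two atoms, some atom remains besides \<open>p\<close> and any
      given \<open>i\<close>. Taking for \<open>i\<close> the atom that a multiplier cancels, if
      any, yields a surviving atom of the majority sign.\<close>
    have "\<exists>j\<in>I. j \<noteq> p \<and> j \<noteq> i" for i
    proof (rule ccontr)
      assume "\<not> ?thesis"
      then have "I \<subseteq> {p, i}" by auto
      then have "finite I" "card I \<le> card {p, i}"
        by (auto intro: finite_subset card_mono)
      moreover have "card {p, i} \<le> 2"
        by (simp add: card_insert_if)
      ultimately show False using * by auto
    qed
    then have "\<exists>j\<in>I. j \<noteq> p \<and> c\<^sup>2 * r j \<noteq> 1" for c :: real
      using one by metis
    then have "0 < c \<and> CPD_weights (\<lambda>n. c * \<alpha> n) \<longleftrightarrow> c = 1 / sqrt (r p)" for c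
    proof (cases "0 < c")
      case True
      obtain j where j: "j \<in> I" "j \<noteq> p" "c\<^sup>2 * r j \<noteq> 1"
        using \<open>\<And>c. \<exists>j\<in>I. j \<noteq> p \<and> c\<^sup>2 * r j \<noteq> 1\<close> by blast
      have "CPD_weights (\<lambda>n. c * \<alpha> n) \<longleftrightarrow> c\<^sup>2 * r p = 1"
      proof
        assume "CPD_weights (\<lambda>n. c * \<alpha> n)"
        \<comment> \<open>The surviving atom \<open>j\<close> excludes the disjunct of the opposite
          sign, so \<open>p\<close> must share its sign or be cancelled; sharing is
          impossible.\<close>
        then have "c\<^sup>2 * r p = 1 \<or> 0 < a p \<and> 0 < a j \<or> a p < 0 \<and> a j < 0"
          using p j by (auto simp: cpd[OF True])
        then show "c\<^sup>2 * r p = 1"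
          using * j by (metis DiffI less_asym singletonD)
      next
        assume "c\<^sup>2 * r p = 1"
        then show "CPD_weights (\<lambda>n. c * \<alpha> n)"
          using * by (auto simp: cpd[OF True])
      qed
      then show ?thesis
        using True \<open>0 < r p\<close> by (simp add: square_mult_eq_1_iff)
    next
      case False
      then show ?thesis
        using \<open>0 < r p\<close> by auto
    qed
    then show "\<exists>!c. 0 < c \<and> CPD_weights (\<lambda>n. c * \<alpha> n)"
      by simp
  }
  {
    assume "(\<exists>p\<in>I. \<exists>q\<in>I. p \<noteq> q \<and> 0 < a p \<and> 0 < a q) \<and>
      (\<exists>p\<in>I. \<exists>q\<in>I. p \<noteq> q \<and> a p < 0 \<and> a q < 0)"
    \<comment> \<open>Of two atoms with the same sign at most one is cancelled, so both signs
      survive under every multiplier.\<close>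
    then have "\<exists>i\<in>I. 0 < a i \<and> c\<^sup>2 * r i \<noteq> 1" "\<exists>i\<in>I. a i < 0 \<and> c\<^sup>2 * r i \<noteq> 1" for c :: real
      using one by metis+
    then show "\<not> (\<exists>c. 0 < c \<and> CPD_weights (\<lambda>n. c * \<alpha> n))"
      using cpd by (metis less_asym)
  }
qed

end
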